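(* Let $q\in(1,2]$, $\mu,L>0$, and let $f:\mathbb{R}^n\to\mathbb{R}$ be continuously differentiable with $x^\star\in\arg\min_{x\in\mathbb{R}^n}f(x)$ and $f^\star=f(x^\star)$. Suppose that $f$ is $\mu$-gradient dominated of order $q$, i.e. $$\frac{q-1}{q}\|\nabla f(x)\|_2^{\frac{q}{q-1}}\ge \mu^{\frac{1}{q-1}}\,(f(x)-f^\star)\qquad\forall x\in\mathbb{R}^n,$$ and $L$-Lipschitz smooth of order $q$, i.e. $$\|\nabla f(y)-\nabla f(x)\|_2\le L\|y-x\|_2^{q-1}\qquad\forall x,y\in\mathbb{R}^n.$$ Put $\kappa=L/\mu$. Let $x_0\in\mathbb{R}^n$ and $x_{k+1}=x_k+\eta F(x_k)$ for $k\ge0$. Then for every $K\ge 0$: (i) ($q$-RGF) if $F(x)=-\nabla f(x)/\|\nabla f(x)\|_2^{\frac{q-2}{q-1}}$ and $\eta=L^{\frac{1}{1-q}}$, then $$f(x_K)-f^\star\le\left(1-\kappa^{\frac{1}{1-q}}\right)^K (f(x_0)-f^\star);$$ (ii) ($q$-SGF) if $F(x)=-\|\nabla f(x)\|_1^{\frac{1}{q-1}}\,\mathrm{sign}(\nabla f(x))$ and $\eta=(n^{\frac q2}L)^{\frac{1}{1-q}}$, then $$f(x_K)-f^\star\le\left(1-(n^{\frac q2}\kappa)^{\frac{1}{1-q}}\right)^K (f(x_0)-f^\star).$$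
   Context: $\mathrm{sign}$ is applied element-wise. Since $q\le2$, $F(x)=-\|\nabla f(x)\|_2^{\frac{2-q}{q-1}}\nabla f(x)$ in (i); in particular $F(x)=0$ when $\nabla f(x)=0$. *)

theory Defs
  imports "HOL-Analysis.Analysis"
begin

definition grad :: "('a::euclidean_space \<Rightarrow> real) \<Rightarrow> 'a \<Rightarrow> 'a" where
  "grad f x = (THE g. GDERIV f x :> g)"

lemma GDERIV_grad:
  fixes f :: "'a::euclidean_space \<Rightarrow> real"
  assumes "f differentiable (at x)"
  shows "GDERIV f x :> grad f x"
proof -
  obtain D where D: "(f has_derivative D) (at x)"
    using assms by (auto simp: differentiable_def)
  have lin: "linear D"
    using D by (rule has_derivative_linear)
  have "D h = h \<bullet> adjoint D 1" for h
    using adjoint_works[OF lin, of h 1] by simp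
  then have "D = (\<lambda>h. h \<bullet> adjoint D 1)"
    by blast
  then have ex: "GDERIV f x :> adjoint D 1"
    using D unfolding gderiv_def by simp
  have uniq: "g = adjoint D 1" if "GDERIV f x :> g" for g
  proof -
    have "(\<lambda>h. h \<bullet> g) = (\<lambda>h. h \<bullet> adjoint D 1)"
      using that ex unfolding gderiv_def by (rule has_derivative_unique)
    then have "\<forall>h. h \<bullet> g = h \<bullet> adjoint D 1"
      by (simp add: fun_eq_iff)
    then show ?thesis
      by (simp only: vector_eq_ldot)
  qed
  show ?thesis
    unfolding grad_def using ex uniq by (rule theI)
qed

definition l1_norm :: "real ^ 'n \<Rightarrow> real" where
  "l1_norm v = (\<Sum>i\<in>UNIV. \<bar>v $ i\<bar>)"

text \<open>On vectors, the library's overloaded \<open>sgn\<close> is normalisation,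
  not the element-wise sign.\<close>

definition sign_vec :: "real ^ 'n \<Rightarrow> real ^ 'n" where
  "sign_vec v = (\<chi> i. sgn (v $ i))"

text \<open>Where the gradient vanishes, \<open>q_RGF\<close> is \<open>0\<close>, whatever value the
  denominator takes.\<close>

definition q_RGF :: "real \<Rightarrow> (real ^ 'n \<Rightarrow> real) \<Rightarrow> real ^ 'n \<Rightarrow> real ^ 'n" where
  "q_RGF q f x = - (grad f x /\<^sub>R (norm (grad f x) powr ((q - 2) / (q - 1))))"

definition q_SGF :: "real \<Rightarrow> (real ^ 'n \<Rightarrow> real) \<Rightarrow> real ^ 'n \<Rightarrow> real ^ 'n" where
  "q_SGF q f x = - (l1_norm (grad f x) powr (1 / (q - 1)) *\<^sub>R sign_vec (grad f x))"

lemma q_RGF_eq: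
  "q_RGF q f x = - (norm (grad f x) powr ((2 - q) / (q - 1)) *\<^sub>R grad f x)"
proof -
  have "(2 - q) / (q - 1) = - ((q - 2) / (q - 1))"
    by (simp add: minus_divide_left)
  then show ?thesis
    by (simp only: q_RGF_def powr_minus)
qed

text \<open>In \<open>is_gradient_dominated q \<mu> f m\<close>, the parameter
  \<open>m\<close> is the minimum value of \<open>f\<close>. All real powers below have base \<open>\<ge> 0\<close> and, for \<open>q > 1\<close>,
  a positive exponent wherever the base can vanish, so \<open>powr\<close> is the usual power.\<close>

definition is_gradient_dominated ::
    "real \<Rightarrow> real \<Rightarrow> (real ^ 'n \<Rightarrow> real) \<Rightarrow> real \<Rightarrow> bool" where
  "is_gradient_dominated q \<mu> f m \<longleftrightarrow>
    (\<forall>x. (q - 1) / q * norm (grad f x) powr (q / (q - 1)) \<ge> \<mu> powr (1 / (q - 1)) * (f x - m))"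

definition is_lipschitz_smooth :: "real \<Rightarrow> real \<Rightarrow> (real ^ 'n \<Rightarrow> real) \<Rightarrow> bool" where
  "is_lipschitz_smooth q L f \<longleftrightarrow>
    (\<forall>x y. norm (grad f y - grad f x) \<le> L * norm (y - x) powr (q - 1))"

end

theory Submission imports Defs begin

text \<open>Integrating the smoothness condition along a segment gives the descent inequality
  \<open>f (x + d) \<le> f x + \<nabla>f x \<bullet> d + L / q * \<bar>d\<bar>\<^sup>q\<close>. Both directions \<open>d\<close> satisfy
  \<open>\<nabla>f x \<bullet> d = - s powr (q / (q - 1))\<close> and \<open>\<bar>d\<bar> \<le> C * s powr (1 / (q - 1))\<close>, where \<open>s\<close> is the 2-norm
  of the gradient and \<open>C = 1\<close>, respectively \<open>s\<close> is its 1-norm and \<open>C = sqrt n\<close>. The step size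
  \<open>\<eta>\<close> is chosen so that \<open>C\<^sup>q * L * \<eta> powr (q - 1) = 1\<close>; then the decrease in one step is at least
  \<open>\<eta> * (q - 1) / q * s powr (q / (q - 1))\<close>, which gradient dominance bounds from below by a multiple
  of \<open>f x - f\<^sup>*\<close>.\<close>

lemma lipschitz_smooth_descent:
  fixes f :: "real ^ 'n \<Rightarrow> real"
  assumes "1 < q" and diff: "\<And>z. f differentiable (at z)"
    and smooth: "is_lipschitz_smooth q L f"
  shows "f (x + d) \<le> f x + grad f x \<bullet> d + L / q * norm d powr q"
proof -
  \<comment> \<open>The claim is \<open>\<phi> 1 \<le> \<phi> 0\<close>. Monotonicity of \<phi>
    replaces the integral: the last term is chosen because \<open>t powr q\<close> has derivative
    \<open>q * t powr (q - 1)\<close>, which matches the smoothness bound at distance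
    \<open>t * norm d\<close>.\<close>
  define \<phi> where "\<phi> t = f (x + t *\<^sub>R d) - t * (grad f x \<bullet> d) - L / q * norm d powr q * t powr q"
    for t :: real
  have deriv: "((\<lambda>t. f (x + t *\<^sub>R d)) has_real_derivative d \<bullet> grad f (x + t *\<^sub>R d)) (at t)" for t
  proof -
    have "(f has_derivative (\<lambda>h. h \<bullet> grad f (x + t *\<^sub>R d))) (at (x + t *\<^sub>R d))"
      using GDERIV_grad[OF diff] unfolding gderiv_def .
    moreover have "((\<lambda>t. x + t *\<^sub>R d) has_derivative (\<lambda>h. h *\<^sub>R d)) (at t)"
      by (auto intro!: derivative_eq_intros)
    ultimately have "((\<lambda>t. f (x + t *\<^sub>R d)) has_derivative
        (\<lambda>h. (h *\<^sub>R d) \<bullet> grad f (x + t *\<^sub>R d))) (at t)"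
      by (rule has_derivative_compose[rotated])
    then show ?thesis
      by (simp add: has_field_derivative_def mult.commute[of _ "d \<bullet> _"])
  qed
  have "\<phi> 1 \<le> \<phi> 0"
  \<comment> \<open>The derivative is needed only for \<open>0 < t < 1\<close>, which avoids
    differentiating \<open>t powr q\<close> at 0; continuity suffices at the endpoints.\<close>
  proof (rule DERIV_nonpos_imp_decreasing_open[of 0 1 \<phi>])
    fix t :: real assume t: "0 < t" "t < 1"
    let ?D = "d \<bullet> grad f (x + t *\<^sub>R d) - grad f x \<bullet> d
      - L / q * norm d powr q * (q * t powr (q - 1))"
    have "(\<phi> has_real_derivative ?D) (at t)"
      unfolding \<phi>_def using t by (auto intro!: derivative_eq_intros deriv)
    moreover have "?D \<le> 0"
    proof -
      have "d \<bullet> grad f (x + t *\<^sub>R d) - grad f x \<bullet> d = (grad f (x + t *\<^sub>R d) - grad f x) \<bullet> d"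
        by (simp add: inner_diff_left inner_diff_right inner_commute)
      also have "\<dots> \<le> norm (grad f (x + t *\<^sub>R d) - grad f x) * norm d"
        by (rule norm_cauchy_schwarz)
      also have "\<dots> \<le> (L * norm (t *\<^sub>R d) powr (q - 1)) * norm d"
        using smooth[unfolded is_lipschitz_smooth_def, rule_format, of "x + t *\<^sub>R d" x]
        by (intro mult_right_mono) auto
      also have "\<dots> = L * t powr (q - 1) * (norm d powr (q - 1) * norm d powr 1)"
        using t by (simp add: powr_mult)
      also have "\<dots> = L * t powr (q - 1) * norm d powr q"
        by (simp only: powr_add[symmetric] diff_add_cancel)
      finally show ?thesis
        using \<open>1 < q\<close> by (simp add: mult_ac)
    qed
    ultimately show "\<exists>y. (\<phi> has_real_derivative y) (at t) \<and> y \<le> 0"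
      by blast
  next
    have "continuous_on {0..1} (\<lambda>t. f (x + t *\<^sub>R d))"
      using deriv by (meson DERIV_isCont continuous_at_imp_continuous_on)
    moreover have "continuous_on {0..1} (\<lambda>t::real. t powr q)"
      using \<open>1 < q\<close> by (intro continuous_on_powr' continuous_intros) auto
    ultimately show "continuous_on {0..1} \<phi>"
      unfolding \<phi>_def
      by - (intro continuous_on_diff continuous_on_mult continuous_on_const continuous_on_id; assumption?)
  qed simp
  then show ?thesis
    using \<open>1 < q\<close> by (simp add: \<phi>_def)
qed

lemma gradient_step_decrease:
  fixes f :: "real ^ 'n \<Rightarrow> real"
  assumes q: "1 < q" and "\<mu> > 0" and "L > 0" and "C > 0" and "s \<ge> 0"
    and diff: "\<And>z. f differentiable (at z)"
    and dom: "is_gradient_dominated q \<mu> f m"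
    and smooth: "is_lipschitz_smooth q L f"
    and inner: "grad f x \<bullet> d = - (s powr (q / (q - 1)))"
    and norm_d: "norm d \<le> C * s powr (1 / (q - 1))"
    and norm_grad: "norm (grad f x) \<le> s"
    and \<eta>: "\<eta> = (C powr q * L) powr (1 / (1 - q))"
  shows "f (x + \<eta> *\<^sub>R d) - m \<le> (1 - (C powr q * (L / \<mu>)) powr (1 / (1 - q))) * (f x - m)"
proof -
  define S where "S = s powr (q / (q - 1))"
  have "\<eta> > 0"
    using \<open>C > 0\<close> \<open>L > 0\<close> by (simp add: \<eta>)
  have "\<eta> powr (q - 1) = (C powr q * L) powr (-1)"
  proof -
    have "1 / (1 - q) * (q - 1) = -1"
      using q by (simp add: divide_simps)
    then show ?thesis
      by (simp only: \<eta> powr_powr)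
  qed
  then have step: "C powr q * L * \<eta> powr (q - 1) = 1"
    using \<open>C > 0\<close> \<open>L > 0\<close> by (simp add: powr_minus field_simps)
  \<comment> \<open>This product is the amount subtracted from 1 in the contraction factor: \<eta>
    comes from the step and the power of \<mu> from gradient dominance.\<close>
  have rate: "\<eta> * \<mu> powr (1 / (q - 1)) = (C powr q * (L / \<mu>)) powr (1 / (1 - q))"
  proof -
    have "1 / (q - 1) = - (1 / (1 - q))"
      using q by (simp add: divide_simps)
    then show ?thesis
      using \<open>C > 0\<close> \<open>L > 0\<close> \<open>\<mu> > 0\<close>
      by (simp add: \<eta> powr_mult powr_divide powr_minus_divide)
  qed
  have "L * norm (\<eta> *\<^sub>R d) powr q \<le> L * (\<eta> * (C * s powr (1 / (q - 1)))) powr q"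
    using \<open>L > 0\<close> \<open>\<eta> > 0\<close> q norm_d
    by (intro mult_left_mono powr_mono2) auto
  also have "\<dots> = (C powr q * L * \<eta> powr q) * S"
    using \<open>\<eta> > 0\<close> \<open>C > 0\<close> by (simp add: powr_mult powr_powr S_def)
  \<comment> \<open>Splitting off one factor \<eta> leaves exactly the product that
    \<open>step\<close> normalises to 1.\<close>
  also have "\<eta> powr q = \<eta> powr (q - 1) * \<eta>"
    using \<open>\<eta> > 0\<close> by (simp add: powr_diff)
  finally have "L * norm (\<eta> *\<^sub>R d) powr q \<le> \<eta> * S"
    by (simp only: mult.assoc[symmetric] step mult_1)
  \<comment> \<open>The remainder consumes at most the fraction \<open>1 / q\<close> of the
    first-order gain \<open>\<eta> * S\<close>. What is left carries the factor
    \<open>(q - 1) / q\<close> of the dominance condition.\<close>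
  then have quad: "L / q * norm (\<eta> *\<^sub>R d) powr q \<le> \<eta> * S / q"
    using q by (simp add: divide_right_mono)
  \<comment> \<open>Dominance is stated in the 2-norm; \<open>norm_grad\<close> transfers it to
    \<open>s\<close>.\<close>
  have "norm (grad f x) powr (q / (q - 1)) \<le> S"
    unfolding S_def using q norm_grad by (intro powr_mono2) auto
  then have "(q - 1) / q * norm (grad f x) powr (q / (q - 1)) \<le> (q - 1) / q * S"
    using q by (intro mult_left_mono) auto
  moreover have "\<mu> powr (1 / (q - 1)) * (f x - m)
      \<le> (q - 1) / q * norm (grad f x) powr (q / (q - 1))"
    using dom by (simp add: is_gradient_dominated_def)
  ultimately have "\<mu> powr (1 / (q - 1)) * (f x - m) \<le> (q - 1) / q * S"
    by linarith
  then have "\<eta> * (\<mu> powr (1 / (q - 1)) * (f x - m)) \<le> \<eta> * ((q - 1) / q * S)"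
    using \<open>\<eta> > 0\<close> by (intro mult_left_mono) auto
  moreover have "\<eta> * ((q - 1) / q * S) = \<eta> * S - \<eta> * S / q"
    using q by (simp add: field_simps)
  ultimately have gain: "(C powr q * (L / \<mu>)) powr (1 / (1 - q)) * (f x - m) \<le> \<eta> * S - \<eta> * S / q"
    by (simp only: rate[symmetric] mult.assoc)
  have "f (x + \<eta> *\<^sub>R d) \<le> f x - \<eta> * S + L / q * norm (\<eta> *\<^sub>R d) powr q"
    using lipschitz_smooth_descent[OF q diff smooth, of x "\<eta> *\<^sub>R d"] inner by (simp add: S_def)
  with quad gain show ?thesis
    unfolding left_diff_distrib mult_1 by linarith
qed

text \<open>The contraction factor may be negative here; nonnegativity of \<open>a\<close> then forces \<open>a\<close> to vanish
  identically.\<close>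

lemma contraction_iterate:
  fixes a :: "nat \<Rightarrow> real"
  assumes nonneg: "\<And>k. 0 \<le> a k" and step: "\<And>k. a (Suc k) \<le> \<rho> * a k"
  shows "a K \<le> \<rho> ^ K * a 0"
proof (cases "\<rho> \<ge> 0")
  case True
  then show ?thesis
  proof (induction K)
    case (Suc K)
    have "\<rho> * a K \<le> \<rho> * (\<rho> ^ K * a 0)"
      using Suc by (intro mult_left_mono) auto
    with step[of K] show ?case
      by (simp add: mult.assoc)
  qed simp
next
  case False
  have "a k = 0" for k
  proof -
    have "0 \<le> \<rho> * a k"
      using nonneg[of "Suc k"] step[of k] by linarith
    with False nonneg[of k] show ?thesis
      by (simp add: zero_le_mult_iff)
  qed
  then show ?thesis
    by simp
qed

lemma l1_norm_nonneg: "0 \<le> l1_norm v"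
  by (simp add: l1_norm_def sum_nonneg)

lemma norm_le_l1_norm: "norm v \<le> l1_norm v"
  unfolding l1_norm_def by (rule norm_le_l1_cart)

text \<open>This duality makes the 1-norm the right choice of \<open>s\<close> for
  \<open>q_SGF\<close>.\<close>

lemma inner_sign_vec: "v \<bullet> sign_vec v = l1_norm v"
  by (simp add: inner_vec_def sign_vec_def l1_norm_def abs_sgn)

lemma norm_sign_vec_le: "norm (sign_vec (v :: real ^ 'n)) \<le> sqrt (real CARD('n))"
proof -
  have "(\<Sum>i\<in>UNIV. sgn (v $ i) * sgn (v $ i)) \<le> (\<Sum>i\<in>(UNIV :: 'n set). 1)"
    by (intro sum_mono) (auto simp: sgn_if)
  then show ?thesis
    by (simp add: norm_eq_sqrt_inner inner_vec_def sign_vec_def)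
qed

lemma powr_conjugate_exponent:
  fixes q s :: real
  assumes "1 < q" and "0 \<le> s"
  shows "s powr (1 / (q - 1)) * s = s powr (q / (q - 1))"
proof -
  have "s powr (1 / (q - 1)) * s = s powr (1 / (q - 1) + 1)"
    using \<open>0 \<le> s\<close> by (simp add: powr_add)
  also have "1 / (q - 1) + 1 = q / (q - 1)"
    using \<open>1 < q\<close> by (simp add: field_simps)
  finally show ?thesis .
qed

lemma norm_q_RGF:
  assumes "1 < q"
  shows "norm (q_RGF q f x) = norm (grad f x) powr (1 / (q - 1))"
proof -
  \<comment> \<open>This also covers a vanishing gradient, since \<open>0 powr a = 0\<close> for
    every \<open>a\<close>, even for \<open>a = 0\<close>, which occurs at
    \<open>q = 2\<close>.\<close>
  have "norm (q_RGF q f x) = norm (grad f x) powr ((2 - q) / (q - 1) + 1)"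
    by (simp add: q_RGF_eq powr_add)
  also have "(2 - q) / (q - 1) + 1 = 1 / (q - 1)"
    using \<open>1 < q\<close> by (simp add: field_simps)
  finally show ?thesis .
qed

lemma inner_q_RGF:
  assumes "1 < q"
  shows "grad f x \<bullet> q_RGF q f x = - (norm (grad f x) powr (q / (q - 1)))"
proof -
  \<comment> \<open>The direction is a nonpositive multiple of the gradient, so Cauchy-Schwarz holds
    with equality.\<close>
  have "grad f x \<bullet> q_RGF q f x = - (norm (q_RGF q f x) * norm (grad f x))"
    by (simp add: q_RGF_eq power2_norm_eq_inner[symmetric] power2_eq_square)
  then show ?thesis
    using \<open>1 < q\<close> by (simp add: norm_q_RGF powr_conjugate_exponent)
qed

lemma norm_q_SGF_le:
  fixes f :: "real ^ 'n \<Rightarrow> real"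
  shows "norm (q_SGF q f x) \<le> sqrt (real CARD('n)) * l1_norm (grad f x) powr (1 / (q - 1))"
  using mult_left_mono[OF norm_sign_vec_le[of "grad f x"],
      of "l1_norm (grad f x) powr (1 / (q - 1))"]
  by (simp add: q_SGF_def mult.commute)

lemma inner_q_SGF:
  assumes "1 < q"
  shows "grad f x \<bullet> q_SGF q f x = - (l1_norm (grad f x) powr (q / (q - 1)))"
  using powr_conjugate_exponent[OF assms l1_norm_nonneg, of "grad f x"]
  by (simp add: q_SGF_def inner_sign_vec)

theorem theorem3:
  fixes f :: "real ^ 'n \<Rightarrow> real"
    and F :: "real ^ 'n \<Rightarrow> real ^ 'n"
    and x :: "nat \<Rightarrow> real ^ 'n"
    and x_star :: "real ^ 'n"
    and q \<mu> L \<kappa> \<eta> f_star :: real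
  assumes "1 < q" and "q \<le> 2" and "\<mu> > 0" and "L > 0"
    and "\<And>z. f differentiable (at z)" and "continuous_on UNIV (grad f)"
    and "is_arg_min f (\<lambda>z. z \<in> UNIV) x_star" and "f_star = f x_star"
    and "is_gradient_dominated q \<mu> f f_star"
    and "is_lipschitz_smooth q L f"
    and "\<kappa> = L / \<mu>"
    and "\<And>k. x (Suc k) = x k + \<eta> *\<^sub>R F (x k)"
  shows "(F = q_RGF q f \<and> \<eta> = L powr (1 / (1 - q)) \<longrightarrow>
           (\<forall>K. f (x K) - f_star \<le> (1 - \<kappa> powr (1 / (1 - q))) ^ K * (f (x 0) - f_star)))
       \<and> (F = q_SGF q f \<and> \<eta> = (real CARD('n) powr (q / 2) * L) powr (1 / (1 - q)) \<longrightarrow>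
           (\<forall>K. f (x K) - f_star \<le>
             (1 - (real CARD('n) powr (q / 2) * \<kappa>) powr (1 / (1 - q))) ^ K * (f (x 0) - f_star)))"
proof -
  \<comment> \<open>Minimality of \<open>x_star\<close> enters here;
    \<open>contraction_iterate\<close> relies on this bound.\<close>
  have nonneg: "0 \<le> f (x k) - f_star" for k
    using assms(7,8) by (auto simp: is_arg_min_def not_less)
  note decrease = gradient_step_decrease[OF \<open>1 < q\<close> \<open>\<mu> > 0\<close> \<open>L > 0\<close> _ _ assms(5,9,10)]
  show ?thesis
  proof (intro conjI impI allI; elim conjE)
    fix K assume F: "F = q_RGF q f" and \<eta>: "\<eta> = L powr (1 / (1 - q))"
    have "f (x (Suc k)) - f_star \<le> (1 - \<kappa> powr (1 / (1 - q))) * (f (x k) - f_star)" for k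
      using decrease[of 1 "norm (grad f (x k))" "x k" "q_RGF q f (x k)" \<eta>] \<open>1 < q\<close>
      by (simp add: norm_q_RGF inner_q_RGF F \<eta> assms(11,12))
    with nonneg show "f (x K) - f_star \<le> (1 - \<kappa> powr (1 / (1 - q))) ^ K * (f (x 0) - f_star)"
      by (rule contraction_iterate)
  next
    fix K assume F: "F = q_SGF q f"
      and \<eta>: "\<eta> = (real CARD('n) powr (q / 2) * L) powr (1 / (1 - q))"
    \<comment> \<open>This is \<open>C powr q\<close> for \<open>C = sqrt n\<close>, the source of
      the dimension factor in the step size and the rate.\<close>
    have "sqrt (real CARD('n)) powr q = real CARD('n) powr (q / 2)"
      by (simp add: powr_half_sqrt[symmetric] powr_powr)
    then have "f (x (Suc k)) - f_star
        \<le> (1 - (real CARD('n) powr (q / 2) * \<kappa>) powr (1 / (1 - q))) * (f (x k) - f_star)" for k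
      using decrease[of "sqrt (real CARD('n))" "l1_norm (grad f (x k))" "x k" "q_SGF q f (x k)" \<eta>]
        \<open>1 < q\<close> norm_q_SGF_le[of q f "x k"]
      by (simp add: inner_q_SGF l1_norm_nonneg norm_le_l1_norm F \<eta> assms(11,12))
    with nonneg show "f (x K) - f_star
        \<le> (1 - (real CARD('n) powr (q / 2) * \<kappa>) powr (1 / (1 - q))) ^ K * (f (x 0) - f_star)"
      by (rule contraction_iterate)
  qed
qed

end
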